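(* Let $p$ be a real number with $0<p<1$ or $p=2$. For $\eta=(\eta_1,\eta_2)\in\mathbb{R}^2$ write $$\eta_{1}=\mathrm{sgn}(\cos\varphi)\,|\eta|_{p}\,|\cos\varphi|^{\frac{2}{p}},\qquad \eta_{2}=\mathrm{sgn}(\sin\varphi)\,|\eta|_{p}\,|\sin\varphi|^{\frac{2}{p}}\qquad(0\leq\varphi<2\pi).$$ Then $$J_{0}^{[p]}(\eta)=\mathcal{O}\bigl(|\eta|_{p}^{-\frac{1}{2}}\bigr)\qquad\text{as }|\eta|_{p}\to\infty$$ uniformly with respect to $\varphi$ in any compact subset of $[0,2\pi)\setminus\{0,\frac{\pi}{2},\pi,\frac{3}{2}\pi\}$. That is, for every compact set $K\subset[0,2\pi)\setminus\{0,\frac{\pi}{2},\pi,\frac{3}{2}\pi\}$ there are constants $C,R>0$ such that $|J_0^{[p]}(\eta)|\le C|\eta|_p^{-1/2}$ for all $\eta$ with $|\eta|_p\ge R$ whose angular parameter $\varphi$ lies in $K$.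
   Context: For $p>0$ and $\eta\in\mathbb{R}^2$, $|\eta|_p:=(|\eta_1|^p+|\eta_2|^p)^{1/p}$. The generalized Bessel function of order zero is, for $\eta\in\mathbb{R}^2$, $$J_{0}^{[p]}(\eta):=\frac{1}{\Gamma^{2}(\frac{1}{p})}\left(\frac{2}{p}\right)^{2}\int_{0}^{1}\cos(\eta_{1}t^{\frac{1}{p}})\cos(\eta_{2}(1-t)^{\frac{1}{p}})\,t^{\frac{1}{p}-1}(1-t)^{\frac{1}{p}-1}\,dt,$$ where $\Gamma$ is the gamma function. $\mathrm{sgn}$ is the sign function with $\mathrm{sgn}(0)=0$. *)

theory Defs
  imports "HOL-Analysis.Analysis"
begin

definition p_abs :: "real \<Rightarrow> real ^ 2 \<Rightarrow> real" where
  "p_abs p \<eta> = (\<bar>\<eta> $ 1\<bar> powr p + \<bar>\<eta> $ 2\<bar> powr p) powr (1 / p)"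

(* For every p > 0 the integrand is absolutely integrable on [0,1]: it is bounded by the
   Beta density with both parameters 1/p.  So the gauge integral is the Lebesgue integral,
   and the values at the endpoints, where 0 powr a = 0 even for a < 0, do not matter. *)
definition gen_Bessel_J0 :: "real \<Rightarrow> real ^ 2 \<Rightarrow> real" where
  "gen_Bessel_J0 p \<eta> =
     1 / (Gamma (1 / p))\<^sup>2 * (2 / p)\<^sup>2 *
     integral {0..1} (\<lambda>t. cos (\<eta> $ 1 * t powr (1 / p)) * cos (\<eta> $ 2 * (1 - t) powr (1 / p))
                          * t powr (1 / p - 1) * (1 - t) powr (1 / p - 1))"

definition has_angle :: "real \<Rightarrow> real ^ 2 \<Rightarrow> real \<Rightarrow> bool" where
  "has_angle p \<eta> \<phi> \<longleftrightarrow>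
     0 \<le> \<phi> \<and> \<phi> < 2 * pi \<and>
     \<eta> $ 1 = sgn (cos \<phi>) * p_abs p \<eta> * \<bar>cos \<phi>\<bar> powr (2 / p) \<and>
     \<eta> $ 2 = sgn (sin \<phi>) * p_abs p \<eta> * \<bar>sin \<phi>\<bar> powr (2 / p)"

end

theory Submission
  imports Defs
begin

text \<open>
  Split the integral at \<open>t = 1/2\<close>. On the left half, \<open>u = t\<^sup>1\<^sup>/\<^sup>p\<close> turns it into an oscillatory
  integral with monotone amplitude \<open>(1 - u\<^sup>p)\<^sup>1\<^sup>/\<^sup>p\<^sup>-\<^sup>1\<close> and phases \<open>\<eta>\<^sub>1 u \<plusminus> \<eta>\<^sub>2 (1 - u\<^sup>p)\<^sup>1\<^sup>/\<^sup>p\<close>.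
  The second derivative of \<open>(1 - u\<^sup>p)\<^sup>1\<^sup>/\<^sup>p\<close> is \<open>(1 - p) u\<^sup>p\<^sup>-\<^sup>2 (1 - u\<^sup>p)\<^sup>1\<^sup>/\<^sup>p\<^sup>-\<^sup>2\<close>, which has constant
  sign and is bounded away from zero for \<open>p \<le> 2\<close>, \<open>p \<noteq> 1\<close>, so van der Corput's lemma bounds this
  half by a multiple of \<open>\<bar>\<eta>\<^sub>2\<bar>\<^sup>-\<^sup>1\<^sup>/\<^sup>2\<close>. Swapping \<open>t\<close> and \<open>1 - t\<close>, the other half is bounded by a
  multiple of \<open>\<bar>\<eta>\<^sub>1\<bar>\<^sup>-\<^sup>1\<^sup>/\<^sup>2\<close>. Away from the axes both \<open>\<bar>\<eta>\<^sub>1\<bar>\<close> and \<open>\<bar>\<eta>\<^sub>2\<bar>\<close> are comparable to \<open>\<bar>\<eta>\<bar>\<^sub>p\<close>.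
\<close>

section \<open>Van der Corput estimates for oscillatory integrals\<close>

text \<open>The second mean value theorem writes the integral as \<open>g a\<close> times an
  integral of \<open>f\<close> over \<open>{a..c}\<close> plus \<open>g b\<close> times one over
  \<open>{c..b}\<close>, and each product is at most \<open>M * N\<close>. This replaces integration
  by parts, so \<open>g\<close> may be merely monotone.\<close>

lemma second_mean_value_bound:
  fixes f g :: "real \<Rightarrow> real"
  assumes f: "f integrable_on {a..b}" and "a \<le> b"
    and g: "mono_on {a..b} g \<or> antimono_on {a..b} g"
    and M: "\<bar>g a\<bar> \<le> M" "\<bar>g b\<bar> \<le> M"
    and N: "\<And>c d. a \<le> c \<Longrightarrow> c \<le> d \<Longrightarrow> d \<le> b \<Longrightarrow> \<bar>integral {c..d} f\<bar> \<le> N"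
  shows "\<bar>integral {a..b} (\<lambda>x. g x * f x)\<bar> \<le> 2 * M * N"
proof -
  have mono: "\<bar>integral {a..b} (\<lambda>x. k x * f x)\<bar> \<le> 2 * M * N"
    if k: "mono_on {a..b} k" and kM: "\<bar>k a\<bar> \<le> M" "\<bar>k b\<bar> \<le> M" for k
  proof -
    have "\<And>x y. \<lbrakk>a \<le> x; x \<le> y; y \<le> b\<rbrakk> \<Longrightarrow> k x \<le> k y"
      using k by (auto simp: monotone_on_def)
    then obtain c where c: "c \<in> {a..b}"
      and eq: "integral {a..b} (\<lambda>x. k x * f x) = k a * integral {a..c} f + k b * integral {c..b} f"
      using second_mean_value_theorem[OF f \<open>a \<le> b\<close>, of k] by blast
    have "\<bar>k a * integral {a..c} f\<bar> \<le> M * N" "\<bar>k b * integral {c..b} f\<bar> \<le> M * N"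
      unfolding abs_mult using N[of a c] N[of c b] c kM by (auto intro!: mult_mono)
    then show ?thesis
      unfolding eq by linarith
  qed
  from g show ?thesis
  proof
    assume "antimono_on {a..b} g"
    then have "mono_on {a..b} (\<lambda>x. - g x)"
      by (auto simp: monotone_on_def)
    from mono[OF this] M show ?thesis
      by simp
  qed (use mono M in blast)
qed

text \<open>Write \<open>cos (h x)\<close> as \<open>1 / h' x\<close> times
  \<open>h' x * cos (h x)\<close>. The second factor is the derivative of \<open>sin (h x)\<close>,
  so its integrals are at most 2 in absolute value; the first is decreasing and at most
  \<open>1 / \<mu>\<close>. The second mean value bound then gives 2 * (1 / \<mu>) * 2.\<close>

lemma van_der_Corput_first:
  fixes h h' :: "real \<Rightarrow> real"
  assumes "a \<le> b" "\<mu> > 0"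
    and h: "\<And>x. x \<in> {a..b} \<Longrightarrow> (h has_real_derivative h' x) (at x)"
    and mono: "mono_on {a..b} h'"
    and ge: "\<And>x. x \<in> {a..b} \<Longrightarrow> h' x \<ge> \<mu>"
  shows "\<bar>integral {a..b} (\<lambda>x. cos (h x))\<bar> \<le> 4 / \<mu>"
proof -
  have hi: "((\<lambda>x. h' x * cos (h x)) has_integral (sin (h d) - sin (h c))) {c..d}"
    if "a \<le> c" "c \<le> d" "d \<le> b" for c d
  proof (rule fundamental_theorem_of_calculus[OF \<open>c \<le> d\<close>])
    fix x assume x: "x \<in> {c..d}"
    have "((\<lambda>x. sin (h x)) has_real_derivative h' x * cos (h x)) (at x)"
      using that x by (auto intro!: derivative_eq_intros h)
    then show "((\<lambda>x. sin (h x)) has_vector_derivative h' x * cos (h x)) (at x within {c..d})"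
      using has_real_derivative_iff_has_vector_derivative has_vector_derivative_at_within by blast
  qed
  have pos: "h' x > 0" if "x \<in> {a..b}" for x
    using ge[OF that] \<open>\<mu> > 0\<close> by linarith
  have "\<bar>integral {a..b} (\<lambda>x. (1 / h' x) * (h' x * cos (h x)))\<bar> \<le> 2 * (1 / \<mu>) * 2"
  proof (rule second_mean_value_bound)
    show "(\<lambda>x. h' x * cos (h x)) integrable_on {a..b}"
      using hi[of a b] \<open>a \<le> b\<close> by blast
    have "antimono_on {a..b} (\<lambda>x. 1 / h' x)"
      using mono pos by (auto simp: monotone_on_def intro!: divide_left_mono)
    then show "mono_on {a..b} (\<lambda>x. 1 / h' x) \<or> antimono_on {a..b} (\<lambda>x. 1 / h' x)" ..
    show "\<bar>1 / h' a\<bar> \<le> 1 / \<mu>" "\<bar>1 / h' b\<bar> \<le> 1 / \<mu>"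
      using ge[of a] ge[of b] \<open>a \<le> b\<close> \<open>\<mu> > 0\<close> by (auto simp: field_simps abs_if)
    fix c d assume "a \<le> c" "c \<le> d" "d \<le> b"
    then have "integral {c..d} (\<lambda>x. h' x * cos (h x)) = sin (h d) - sin (h c)"
      using hi integral_unique by blast
    then show "\<bar>integral {c..d} (\<lambda>x. h' x * cos (h x))\<bar> \<le> 2"
      using abs_sin_le_one[of "h d"] abs_sin_le_one[of "h c"] by linarith
  qed fact
  moreover have "integral {a..b} (\<lambda>x. (1 / h' x) * (h' x * cos (h x)))
      = integral {a..b} (\<lambda>x. cos (h x))"
    using pos by (intro integral_cong) (auto simp: less_imp_neq[symmetric])
  ultimately show ?thesis
    by simp
qed

lemma abs_integral_cos_le_length:
  fixes h :: "real \<Rightarrow> real"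
  assumes "a \<le> b" "continuous_on {a..b} h"
  shows "\<bar>integral {a..b} (\<lambda>x. cos (h x))\<bar> \<le> b - a"
  using integral_bound[of a b "\<lambda>x. cos (h x)" 1] assms
  by (simp add: continuous_on_cos)

text \<open>Only the interior is assumed smooth, since the phases below have infinite slope at an endpoint.\<close>

lemma van_der_Corput_second_nonneg:
  fixes h h' :: "real \<Rightarrow> real"
  assumes "a \<le> b" "\<nu> > 0"
    and cont: "continuous_on {a..b} h"
    and h: "\<And>x. x \<in> {a<..<b} \<Longrightarrow> (h has_real_derivative h' x) (at x)"
    and incr: "\<And>x y. a < x \<Longrightarrow> x < y \<Longrightarrow> y < b \<Longrightarrow> h' y - h' x \<ge> \<nu> * (y - x)"
    and nonneg: "\<And>x. x \<in> {a<..<b} \<Longrightarrow> h' x \<ge> 0"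
  shows "\<bar>integral {a..b} (\<lambda>x. cos (h x))\<bar> \<le> 10 / sqrt \<nu>"
proof -
  \<comment> \<open>This length balances the trivial bound \<delta> on each end piece against the
    bound of order 1 / (\<nu> \<delta>) on the middle; the total is \<delta> + 8 \<delta> +
    \<delta>.\<close>
  define \<delta> where "\<delta> = 1 / sqrt \<nu>"
  have \<delta>: "\<delta> > 0" and \<nu>\<delta>: "\<nu> * \<delta> = sqrt \<nu>"
    using \<open>\<nu> > 0\<close> by (auto simp: \<delta>_def real_div_sqrt)
  have int: "(\<lambda>x. cos (h x)) integrable_on {c..d}" if "a \<le> c" "d \<le> b" for c d
    using that by (intro integrable_continuous_real continuous_on_cos
        continuous_on_subset[OF cont]) auto
  show ?thesis
  proof (cases "b - a \<le> 2 * \<delta>")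
    case True
    then have "\<bar>integral {a..b} (\<lambda>x. cos (h x))\<bar> \<le> 2 * \<delta>"
      using abs_integral_cos_le_length[OF \<open>a \<le> b\<close> cont] by linarith
    also have "\<dots> \<le> 10 / sqrt \<nu>"
      using \<open>\<nu> > 0\<close> by (simp add: \<delta>_def divide_right_mono)
    finally show ?thesis .
  next
    case False
    let ?I = "\<lambda>c d. integral {c..d} (\<lambda>x. cos (h x))"
    have "?I a b = ?I a (a + \<delta>) + ?I (a + \<delta>) b"
      using False \<delta> by (intro Henstock_Kurzweil_Integration.integral_combine[symmetric] int) auto
    also have "?I (a + \<delta>) b = ?I (a + \<delta>) (b - \<delta>) + ?I (b - \<delta>) b"
      using False \<delta> by (intro Henstock_Kurzweil_Integration.integral_combine[symmetric] int) auto
    finally have split: "?I a b = ?I a (a + \<delta>) + (?I (a + \<delta>) (b - \<delta>) + ?I (b - \<delta>) b)" .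
    have ends: "\<bar>?I a (a + \<delta>)\<bar> \<le> \<delta>" "\<bar>?I (b - \<delta>) b\<bar> \<le> \<delta>"
      using False \<delta> abs_integral_cos_le_length[of a "a + \<delta>" h]
        abs_integral_cos_le_length[of "b - \<delta>" b h]
        continuous_on_subset[OF cont, of "{a..a + \<delta>}"] continuous_on_subset[OF cont, of "{b - \<delta>..b}"]
      by auto
    have "\<bar>?I (a + \<delta>) (b - \<delta>)\<bar> \<le> 4 / (sqrt \<nu> / 2)"
    proof (rule van_der_Corput_first)
      show "mono_on {a + \<delta>..b - \<delta>} h'"
      proof (intro monotone_onI)
        fix x y assume "x \<in> {a + \<delta>..b - \<delta>}" "y \<in> {a + \<delta>..b - \<delta>}" "x \<le> y"
        then have "\<nu> * (y - x) \<ge> 0" "x \<noteq> y \<Longrightarrow> h' y - h' x \<ge> \<nu> * (y - x)"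
          using \<open>\<nu> > 0\<close> \<delta> by (auto intro: incr)
        then show "h' x \<le> h' y"
          by (cases "x = y") auto
      qed
      fix x assume x: "x \<in> {a + \<delta>..b - \<delta>}"
      \<comment> \<open>Nothing is assumed about \<open>h'\<close> at \<open>a\<close> itself, so
        growth is measured from the interior point \<open>a + \<delta> / 2\<close>, at the cost of a
        factor 2.\<close>
      have "sqrt \<nu> / 2 = \<nu> * (\<delta> / 2)"
        using \<nu>\<delta> by simp
      also have "\<dots> \<le> \<nu> * (x - (a + \<delta> / 2))"
        using x \<open>\<nu> > 0\<close> by (intro mult_left_mono) (auto simp: field_simps)
      also have "\<dots> \<le> h' x"
        using incr[of "a + \<delta> / 2" x] nonneg[of "a + \<delta> / 2"] x \<delta> by auto
      finally show "sqrt \<nu> / 2 \<le> h' x" .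
      show "(h has_real_derivative h' x) (at x)"
        using x \<delta> by (intro h) auto
    qed (use False \<open>\<nu> > 0\<close> in auto)
    also have "4 / (sqrt \<nu> / 2) = 8 * \<delta>"
      by (simp add: \<delta>_def)
    finally have "\<bar>?I a b\<bar> \<le> 10 * \<delta>"
      using split ends by linarith
    then show ?thesis
      by (simp add: \<delta>_def)
  qed
qed

text \<open>Since \<open>h'\<close> increases, it changes sign at most once. To the right of that
  point the nonnegative case applies directly; to the left it applies after the reflection of x to
  -x, which turns the derivative into \<open>- h' (- x)\<close>. Hence 20 = 10 + 10.\<close>

lemma van_der_Corput_second:
  fixes h h' :: "real \<Rightarrow> real"
  assumes "a \<le> b" "\<nu> > 0"
    and cont: "continuous_on {a..b} h"
    and h: "\<And>x. x \<in> {a<..<b} \<Longrightarrow> (h has_real_derivative h' x) (at x)"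
    and incr: "\<And>x y. a < x \<Longrightarrow> x < y \<Longrightarrow> y < b \<Longrightarrow> h' y - h' x \<ge> \<nu> * (y - x)"
  shows "\<bar>integral {a..b} (\<lambda>x. cos (h x))\<bar> \<le> 20 / sqrt \<nu>"
proof -
  \<comment> \<open>Inserting \<open>a\<close> keeps the set nonempty when \<open>h'\<close> is
    nowhere negative; then the split point \<open>m\<close> is \<open>a\<close>.\<close>
  define S where "S = insert a {x \<in> {a<..<b}. h' x < 0}"
  define m where "m = Sup S"
  have bdd: "bdd_above S" and "S \<noteq> {}"
    using \<open>a \<le> b\<close> by (auto simp: S_def bdd_above_def intro!: exI[of _ b])
  have "a \<le> m"
    unfolding m_def by (rule cSup_upper[OF _ bdd]) (simp add: S_def)
  have "m \<le> b"
    unfolding m_def using \<open>a \<le> b\<close> by (intro cSup_least[OF \<open>S \<noteq> {}\<close>]) (auto simp: S_def)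
  have right: "h' x \<ge> 0" if "x \<in> {m<..<b}" for x
  proof (rule ccontr)
    assume "\<not> h' x \<ge> 0"
    then have "x \<in> S"
      using that \<open>a \<le> m\<close> by (auto simp: S_def)
    from cSup_upper[OF this bdd] that show False
      by (simp add: m_def)
  qed
  have left: "h' x \<le> 0" if x: "x \<in> {a<..<m}" for x
  proof -
    obtain y where y: "y \<in> S" "x < y"
      using x less_cSup_iff[OF \<open>S \<noteq> {}\<close> bdd] by (auto simp: m_def)
    then have "y < b" "h' y < 0"
      using x by (auto simp: S_def)
    moreover have "\<nu> * (y - x) \<ge> 0"
      using y \<open>\<nu> > 0\<close> by simp
    ultimately show ?thesis
      using incr[of x y] x y by auto
  qed
  have "\<bar>integral {m..b} (\<lambda>x. cos (h x))\<bar> \<le> 10 / sqrt \<nu>"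
    using \<open>a \<le> m\<close> \<open>m \<le> b\<close> right
    by (intro van_der_Corput_second_nonneg[where h' = h'] \<open>\<nu> > 0\<close>
        continuous_on_subset[OF cont] h incr) auto
  moreover have "\<bar>integral {-m..-a} (\<lambda>x. cos (h (- x)))\<bar> \<le> 10 / sqrt \<nu>"
  proof (rule van_der_Corput_second_nonneg[where h' = "\<lambda>x. - h' (- x)"])
    show "continuous_on {-m..-a} (\<lambda>x. h (- x))"
      using \<open>m \<le> b\<close> by (intro continuous_on_compose2[OF cont] continuous_intros) auto
    show "((\<lambda>x. h (- x)) has_real_derivative - h' (- x)) (at x)" if "x \<in> {-m<..<-a}" for x
      using that \<open>m \<le> b\<close> by (intro DERIV_mirror[THEN iffD1] h) auto
    show "- h' (- y) - - h' (- x) \<ge> \<nu> * (y - x)" if "-m < x" "x < y" "y < -a" for x y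
      using incr[of "- y" "- x"] that \<open>m \<le> b\<close> by (auto simp: algebra_simps)
  qed (use \<open>a \<le> m\<close> \<open>\<nu> > 0\<close> left in auto)
  moreover have "integral {a..b} (\<lambda>x. cos (h x))
      = integral {a..m} (\<lambda>x. cos (h x)) + integral {m..b} (\<lambda>x. cos (h x))"
    using \<open>a \<le> m\<close> \<open>m \<le> b\<close> cont
    by (intro Henstock_Kurzweil_Integration.integral_combine[symmetric] integrable_continuous_real continuous_on_cos) auto
  ultimately show ?thesis
    using Henstock_Kurzweil_Integration.integral_reflect_real[of m a "\<lambda>x. cos (h x)"] by auto
qed

text \<open>By the mean value theorem the bound on \<open>h''\<close> becomes the growth condition
  on \<open>h'\<close>, and it passes to every subinterval. So the second mean value bound applies
  with N = 20 / sqrt \<nu>. A negative \<open>h''\<close> is handled by passing to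
  \<open>- h\<close>, since cosine is even.\<close>

lemma van_der_Corput_second_amplitude:
  fixes h h' h'' A :: "real \<Rightarrow> real"
  assumes "a \<le> b" "\<nu> > 0"
    and cont: "continuous_on {a..b} h"
    and h: "\<And>x. x \<in> {a<..<b} \<Longrightarrow> (h has_real_derivative h' x) (at x)"
    and h': "\<And>x. x \<in> {a<..<b} \<Longrightarrow> (h' has_real_derivative h'' x) (at x)"
    and h'': "(\<forall>x\<in>{a<..<b}. h'' x \<ge> \<nu>) \<or> (\<forall>x\<in>{a<..<b}. h'' x \<le> - \<nu>)"
    and A: "mono_on {a..b} A \<or> antimono_on {a..b} A" "\<bar>A a\<bar> \<le> M" "\<bar>A b\<bar> \<le> M"
  shows "\<bar>integral {a..b} (\<lambda>x. A x * cos (h x))\<bar> \<le> 40 * M / sqrt \<nu>"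
proof -
  have main: "\<bar>integral {a..b} (\<lambda>x. A x * cos (k x))\<bar> \<le> 2 * M * (20 / sqrt \<nu>)"
    if cont: "continuous_on {a..b} k"
      and k: "\<And>x. x \<in> {a<..<b} \<Longrightarrow> (k has_real_derivative k' x) (at x)"
      and k': "\<And>x. x \<in> {a<..<b} \<Longrightarrow> (k' has_real_derivative k'' x) (at x)"
      and k'': "\<And>x. x \<in> {a<..<b} \<Longrightarrow> k'' x \<ge> \<nu>" for k k' k''
  proof (rule second_mean_value_bound[OF _ \<open>a \<le> b\<close> A])
    show "(\<lambda>x. cos (k x)) integrable_on {a..b}"
      by (intro integrable_continuous_real continuous_on_cos cont)
    fix c d assume cd: "a \<le> c" "c \<le> d" "d \<le> b"
    show "\<bar>integral {c..d} (\<lambda>x. cos (k x))\<bar> \<le> 20 / sqrt \<nu>"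
    proof (rule van_der_Corput_second[OF \<open>c \<le> d\<close> \<open>\<nu> > 0\<close>])
      fix x y assume xy: "c < x" "x < y" "y < d"
      then obtain z where z: "x < z" "z < y" "k' y - k' x = (y - x) * k'' z"
        using MVT2[of x y k' k''] k' cd by force
      then have "k'' z \<ge> \<nu>"
        using k'' cd xy by auto
      then show "k' y - k' x \<ge> \<nu> * (y - x)"
        using z xy by (simp add: mult.commute mult_left_mono)
    qed (use cd in \<open>auto intro: k continuous_on_subset[OF cont]\<close>)
  qed
  from h'' show ?thesis
  proof
    assume "\<forall>x\<in>{a<..<b}. h'' x \<ge> \<nu>"
    then show ?thesis
      using main[OF cont h h'] by (simp add: mult.commute)
  next
    assume le: "\<forall>x\<in>{a<..<b}. h'' x \<le> - \<nu>"
    have "\<bar>integral {a..b} (\<lambda>x. A x * cos (- h x))\<bar> \<le> 2 * M * (20 / sqrt \<nu>)"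
    proof (rule main)
      show "((\<lambda>x. - h x) has_real_derivative - h' x) (at x)"
        "((\<lambda>x. - h' x) has_real_derivative - h'' x) (at x)" "- h'' x \<ge> \<nu>"
        if "x \<in> {a<..<b}" for x
        using that le h h' by (force intro: derivative_intros)+
    qed (intro continuous_intros cont)
    then show ?thesis
      by (simp add: mult.commute)
  qed
qed

section \<open>Curvature of the curve and size of the amplitude\<close>

text \<open>The minimum and maximum cover both signs of the exponent: \<open>1 / p - 2\<close> and
  \<open>1 / p - 1\<close>, to which this is applied, change sign with p.\<close>

lemma powr_between_half_one:
  fixes w r :: real
  assumes "1 / 2 \<le> w" "w \<le> 1"
  shows "w powr r \<ge> min 1 ((1 / 2) powr r)" "w powr r \<le> max 1 ((1 / 2) powr r)"
proof -
  consider "r \<ge> 0" | "r \<le> 0" by linarith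
  then have "w powr r \<ge> min 1 ((1 / 2) powr r) \<and> w powr r \<le> max 1 ((1 / 2) powr r)"
  proof cases
    case 1
    then show ?thesis
      using powr_mono2[of r "1 / 2" w] powr_mono2[of r w 1] assms by auto
  next
    case 2
    then show ?thesis
      using powr_mono2'[of r "1 / 2" w] powr_mono2'[of r w 1] assms by auto
  qed
  then show "w powr r \<ge> min 1 ((1 / 2) powr r)" "w powr r \<le> max 1 ((1 / 2) powr r)"
    by auto
qed

text \<open>The image of the split point t = 1/2 under u = t^(1/p). Up to it, 1 - u^p stays between
  1/2 and 1.\<close>

definition half_root :: "real \<Rightarrow> real" where
  "half_root p = (1 / 2) powr (1 / p)"

text \<open>A lower bound for the absolute second derivative of (1 - u^p)^(1/p) on the open interval
  from 0 to \<open>half_root p\<close>. The factor \<bar>1 - p\<bar> reflects that the curve is a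
  straight line for p = 1.\<close>

definition curvature_bound :: "real \<Rightarrow> real" where
  "curvature_bound p = \<bar>1 - p\<bar> * min 1 ((1 / 2) powr (1 / p - 2))"

definition amplitude_bound :: "real \<Rightarrow> real" where
  "amplitude_bound p = max 1 ((1 / 2) powr (1 / p - 1))"

text \<open>The two coordinates are separate arguments so that replacing t by 1 - t amounts to
  exchanging \<open>x\<close> and \<open>y\<close>.\<close>

definition Bessel_integrand :: "real \<Rightarrow> real \<Rightarrow> real \<Rightarrow> real \<Rightarrow> real" where
  "Bessel_integrand p x y t = cos (x * t powr (1 / p)) * cos (y * (1 - t) powr (1 / p))
     * t powr (1 / p - 1) * (1 - t) powr (1 / p - 1)"

context
  fixes p :: real
  assumes p: "0 < p" "p \<le> 2" "p \<noteq> 1"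
begin

lemma half_root_pos: "0 < half_root p" and half_root_le_one: "half_root p \<le> 1"
  using p powr_mono2[of "1 / p" "1 / 2" 1] by (auto simp: half_root_def)

lemma one_minus_powr_bounds:
  assumes "0 \<le> u" "u \<le> half_root p"
  shows "1 / 2 \<le> 1 - u powr p" "1 - u powr p \<le> 1"
proof -
  have "u powr p \<le> half_root p powr p"
    using assms p by (intro powr_mono2) auto
  also have "half_root p powr p = 1 / 2"
    using p by (simp add: half_root_def powr_powr)
  finally show "1 / 2 \<le> 1 - u powr p" "1 - u powr p \<le> 1" by auto
qed

lemma amplitude_monotone:
  "mono_on {0..half_root p} (\<lambda>u. (1 - u powr p) powr r) \<or>
   antimono_on {0..half_root p} (\<lambda>u. (1 - u powr p) powr r)"
proof (cases "r \<ge> 0")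
  case True
  have "(1 - v powr p) powr r \<le> (1 - u powr p) powr r" if "0 \<le> u" "u \<le> v" "v \<le> half_root p" for u v
    using that True p one_minus_powr_bounds[of v] by (intro powr_mono2) (auto intro: powr_mono2)
  then show ?thesis
    by (auto simp: monotone_on_def)
next
  case False
  have "(1 - u powr p) powr r \<le> (1 - v powr p) powr r" if "0 \<le> u" "u \<le> v" "v \<le> half_root p" for u v
    using that False p one_minus_powr_bounds[of v] by (intro powr_mono2') (auto intro: powr_mono2)
  then show ?thesis
    by (auto simp: monotone_on_def)
qed

lemma curve_derivative:
  assumes u: "u \<in> {0<..<half_root p}"
  shows "((\<lambda>u. (1 - u powr p) powr (1 / p)) has_real_derivative
           - (u powr (p - 1) * (1 - u powr p) powr (1 / p - 1))) (at u)"
proof -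
  have "1 - u powr p > 0"
    using one_minus_powr_bounds[of u] u by auto
  then show ?thesis
    using u p by (auto intro!: derivative_eq_intros)
qed

text \<open>With w = 1 - u^p, the product rule gives two terms with common factor (1 - p) w^(1/p -
  2). As u^(2p - 2) = u^p u^(p - 2) and w + u^p = 1, they merge into a single term, whose sign is
  that of 1 - p.\<close>

lemma curve_second_derivative:
  assumes u: "u \<in> {0<..<half_root p}"
  shows "((\<lambda>u. - (u powr (p - 1) * (1 - u powr p) powr (1 / p - 1))) has_real_derivative
           (1 - p) * u powr (p - 2) * (1 - u powr p) powr (1 / p - 2)) (at u)"
proof -
  define w where "w = 1 - u powr p"
  have w: "w > 0"
    using one_minus_powr_bounds[of u] u by (auto simp: w_def)
  have 1: "w powr (1 / p - 1) = w * w powr (1 / p - 2)"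
    using w powr_mult_base[of w "1 / p - 2"] by (simp add: algebra_simps)
  have 2: "u powr (p - 1) * u powr (p - 1) = u powr p * u powr (p - 2)"
    by (simp flip: powr_add)
  have "((\<lambda>u. - (u powr (p - 1) * (1 - u powr p) powr (1 / p - 1))) has_real_derivative
      - ((p - 1) * u powr (p - 2) * w powr (1 / p - 1)
        - u powr (p - 1) * ((1 / p - 1) * w powr (1 / p - 2) * (p * u powr (p - 1))))) (at u)"
    using u w by (auto intro!: derivative_eq_intros simp: w_def algebra_simps)
  also have "- ((p - 1) * u powr (p - 2) * w powr (1 / p - 1)
        - u powr (p - 1) * ((1 / p - 1) * w powr (1 / p - 2) * (p * u powr (p - 1))))
     = (1 - p) * w powr (1 / p - 2) * (u powr (p - 2) * w + u powr (p - 1) * u powr (p - 1))"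
    unfolding 1 using p by (simp add: field_simps)
  also have "u powr (p - 2) * w + u powr (p - 1) * u powr (p - 1) = u powr (p - 2)"
    unfolding 2 by (simp add: w_def algebra_simps)
  finally show ?thesis
    by (simp add: w_def mult_ac)
qed

lemma curvature_bound_pos: "curvature_bound p > 0"
  using p by (auto simp: curvature_bound_def)

text \<open>Here p \<le> 2 enters: with 0 < u \<le> 1 it makes u^(p - 2) at least 1. The other
  factor is a power of a number in [1/2, 1].\<close>

lemma curve_second_derivative_bound:
  assumes u: "u \<in> {0<..<half_root p}"
  shows "min 1 ((1 / 2) powr (1 / p - 2)) \<le> u powr (p - 2) * (1 - u powr p) powr (1 / p - 2)"
proof -
  have "1 * min 1 ((1 / 2) powr (1 / p - 2)) \<le> u powr (p - 2) * (1 - u powr p) powr (1 / p - 2)"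
  proof (rule mult_mono)
    show "1 \<le> u powr (p - 2)"
      using powr_mono2'[of "p - 2" u 1] u p half_root_le_one by auto
    show "min 1 ((1 / 2) powr (1 / p - 2)) \<le> (1 - u powr p) powr (1 / p - 2)"
      using one_minus_powr_bounds[of u] u by (intro powr_between_half_one) auto
  qed auto
  then show ?thesis by simp
qed

text \<open>The linear term \<open>x * u\<close> vanishes from the second derivative of the phase,
  so the bound is uniform in \<open>x\<close>. The sign of \<open>y * (1 - p)\<close> decides
  between the convex and the concave case.\<close>

lemma phase_integral_bound:
  assumes y: "y \<noteq> 0"
  shows "\<bar>integral {0..half_root p} (\<lambda>u. (1 - u powr p) powr (1 / p - 1)
            * cos (x * u + y * (1 - u powr p) powr (1 / p)))\<bar> \<le>
    40 * amplitude_bound p / sqrt (curvature_bound p * \<bar>y\<bar>)"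
proof (rule van_der_Corput_second_amplitude
    [where h' = "\<lambda>u. x + y * - (u powr (p - 1) * (1 - u powr p) powr (1 / p - 1))"
       and h'' = "\<lambda>u. y * ((1 - p) * u powr (p - 2) * (1 - u powr p) powr (1 / p - 2))"])
  show "continuous_on {0..half_root p} (\<lambda>u. x * u + y * (1 - u powr p) powr (1 / p))"
    using p one_minus_powr_bounds by (intro continuous_intros continuous_on_powr') force+
  fix u assume u: "u \<in> {0<..<half_root p}"
  show "((\<lambda>u. x * u + y * (1 - u powr p) powr (1 / p)) has_real_derivative
      x + y * - (u powr (p - 1) * (1 - u powr p) powr (1 / p - 1))) (at u)"
    using DERIV_add[OF DERIV_cmult[OF DERIV_ident] DERIV_cmult[OF curve_derivative[OF u]], of x y]
    by simp
  show "((\<lambda>u. x + y * - (u powr (p - 1) * (1 - u powr p) powr (1 / p - 1))) has_real_derivative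
      y * ((1 - p) * u powr (p - 2) * (1 - u powr p) powr (1 / p - 2))) (at u)"
    using DERIV_add[OF DERIV_const DERIV_cmult[OF curve_second_derivative[OF u]], of x y] by simp
next
  let ?q = "y * (1 - p)"
  let ?h'' = "\<lambda>u. y * ((1 - p) * u powr (p - 2) * (1 - u powr p) powr (1 / p - 2))"
  have "\<bar>?q\<bar> * min 1 ((1 / 2) powr (1 / p - 2)) = curvature_bound p * \<bar>y\<bar>"
    by (simp add: curvature_bound_def abs_mult mult_ac)
  then have le: "curvature_bound p * \<bar>y\<bar> \<le> \<bar>?q\<bar> * (u powr (p - 2) * (1 - u powr p) powr (1 / p - 2))"
    if "u \<in> {0<..<half_root p}" for u
    using mult_left_mono[OF curve_second_derivative_bound[OF that], of "\<bar>?q\<bar>"] by simp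
  show "(\<forall>u\<in>{0<..<half_root p}. ?h'' u \<ge> curvature_bound p * \<bar>y\<bar>) \<or>
    (\<forall>u\<in>{0<..<half_root p}. ?h'' u \<le> - (curvature_bound p * \<bar>y\<bar>))"
  proof (cases "?q \<ge> 0")
    case True
    then show ?thesis
      using le by (intro disjI1) (simp add: mult_ac)
  next
    case False
    then show ?thesis
      using le by (intro disjI2) (force simp: mult_ac)
  qed
  show "\<bar>(1 - 0 powr p) powr (1 / p - 1)\<bar> \<le> amplitude_bound p"
    "\<bar>(1 - half_root p powr p) powr (1 / p - 1)\<bar> \<le> amplitude_bound p"
    using powr_between_half_one(2)[OF one_minus_powr_bounds] half_root_pos by (auto simp: amplitude_bound_def)
qed (use half_root_pos curvature_bound_pos y amplitude_monotone in auto)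

section \<open>Estimating the Bessel integral\<close>

text \<open>Under u = t^(1/p) the weight t^(1/p - 1) is absorbed into du, leaving a factor p, and
  the product of cosines is the mean of the cosines of the two phases with \<open>y\<close> and
  \<open>- y\<close>. Existence of the integral is part of the result because the two halves are
  glued later.\<close>

lemma Bessel_integral_first_half:
  assumes y: "y \<noteq> 0"
  obtains I where "(Bessel_integrand p x y has_integral I) {0..1/2}"
    "\<bar>I\<bar> \<le> 40 * p * amplitude_bound p / sqrt (curvature_bound p * \<bar>y\<bar>)"
proof -
  let ?f = "\<lambda>z u. (1 - u powr p) powr (1 / p - 1) * cos (x * u + z * (1 - u powr p) powr (1 / p))"
  let ?F = "\<lambda>u. (?f y u + ?f (- y) u) / 2"
  have cont: "continuous_on {0..half_root p} (?f z)" for z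
    using p one_minus_powr_bounds by (intro continuous_intros continuous_on_powr') force+
  have "((\<lambda>t. (1 / p * t powr (1 / p - 1)) *\<^sub>R ?F (t powr (1 / p))) has_integral
      integral {0 powr (1 / p)..(1 / 2) powr (1 / p)} ?F) {0..1/2}"
  \<comment> \<open>The point 0 is exceptional: for p = 2 the map t^(1/p) has infinite slope
    there.\<close>
  proof (rule has_integral_substitution_strong[of "{0}" 0 "1 / 2" _ 0 "half_root p"])
    show "(\<lambda>t. t powr (1 / p)) ` {0..1 / 2} \<subseteq> {0..half_root p}"
      using p by (auto simp: half_root_def intro!: powr_mono2)
    show "continuous_on {0..half_root p} ?F"
      by (intro continuous_on_divide continuous_on_add continuous_on_const cont) auto
    show "continuous_on {0..1 / 2} (\<lambda>t. t powr (1 / p))"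
      using p by (intro continuous_on_powr' continuous_intros) auto
    show "((\<lambda>t. t powr (1 / p)) has_real_derivative 1 / p * t powr (1 / p - 1)) (at t within {0..1 / 2})"
      if "t \<in> {0..1 / 2} - {0}" for t
      using that by (intro has_field_derivative_at_within[OF has_real_derivative_powr]) auto
  qed auto
  then have "((\<lambda>t. p * ((1 / p * t powr (1 / p - 1)) *\<^sub>R ?F (t powr (1 / p)))) has_integral
      p * integral {0..half_root p} ?F) {0..1/2}"
    using p by (intro has_integral_mult_right) (simp add: half_root_def)
  moreover have "p * ((1 / p * t powr (1 / p - 1)) *\<^sub>R ?F (t powr (1 / p))) = Bessel_integrand p x y t"
    if "t \<in> {0..1/2}" for t
  proof -
    have "(t powr (1 / p)) powr p = t"
      using that p by (simp add: powr_powr)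
    then show ?thesis
      using p by (simp add: Bessel_integrand_def cos_add cos_diff algebra_simps)
  qed
  ultimately have "(Bessel_integrand p x y has_integral p * integral {0..half_root p} ?F) {0..1/2}"
    by (rule has_integral_eq[rotated])
  moreover have "\<bar>p * integral {0..half_root p} ?F\<bar> \<le> 40 * p * amplitude_bound p / sqrt (curvature_bound p * \<bar>y\<bar>)"
  proof -
    have "integral {0..half_root p} ?F = (integral {0..half_root p} (?f y) + integral {0..half_root p} (?f (- y))) / 2"
      unfolding integral_divide
      by (subst integral_add) (intro integrable_continuous_real cont refl)+
    then have "\<bar>integral {0..half_root p} ?F\<bar> \<le> 40 * amplitude_bound p / sqrt (curvature_bound p * \<bar>y\<bar>)"
      using phase_integral_bound[of y x] phase_integral_bound[of "- y" x] y
      by (simp add: abs_le_iff)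
    then have "p * \<bar>integral {0..half_root p} ?F\<bar> \<le> p * (40 * amplitude_bound p / sqrt (curvature_bound p * \<bar>y\<bar>))"
      using p by (intro mult_left_mono) auto
    then show ?thesis
      using p by (simp add: abs_mult mult_ac)
  qed
  ultimately show ?thesis ..
qed

lemma Bessel_integral_bound:
  assumes "x \<noteq> 0" "y \<noteq> 0"
  shows "\<bar>integral {0..1} (Bessel_integrand p x y)\<bar>
    \<le> 40 * p * amplitude_bound p / sqrt (curvature_bound p * \<bar>x\<bar>)
      + 40 * p * amplitude_bound p / sqrt (curvature_bound p * \<bar>y\<bar>)"
proof -
  obtain I where I: "(Bessel_integrand p x y has_integral I) {0..1/2}"
    "\<bar>I\<bar> \<le> 40 * p * amplitude_bound p / sqrt (curvature_bound p * \<bar>y\<bar>)"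
    using Bessel_integral_first_half[OF \<open>y \<noteq> 0\<close>] .
  obtain I' where I': "(Bessel_integrand p y x has_integral I') {0..1/2}"
    "\<bar>I'\<bar> \<le> 40 * p * amplitude_bound p / sqrt (curvature_bound p * \<bar>x\<bar>)"
    using Bessel_integral_first_half[OF \<open>x \<noteq> 0\<close>] .
  \<comment> \<open>The reflection of t to 1 - t carries the first-half result with \<open>x\<close>
    and \<open>y\<close> exchanged onto \<open>{1/2..1}\<close>.\<close>
  have "((\<lambda>t. Bessel_integrand p y x (- 1 * t + 1)) has_integral (1 / \<bar>- 1\<bar>) *\<^sub>R I')
      ((\<lambda>t. (1 / - 1) * t + - ((1 / - 1) * 1)) ` {0..1/2})"
    using has_integral_affinity[of "Bessel_integrand p y x" I' 0 "1/2" "- 1" 1] I' by simp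
  also have "(\<lambda>t. (1 / - 1) * t + - ((1 / - 1) * 1)) ` {0..1/2} = {1/2..1::real}"
    by (simp add: image_affinity_atLeastAtMost)
  finally have "((\<lambda>t. Bessel_integrand p y x (- 1 * t + 1)) has_integral I') {1/2..1}"
    by simp
  also have "(\<lambda>t. Bessel_integrand p y x (- 1 * t + 1)) = Bessel_integrand p x y"
    by (simp add: Bessel_integrand_def fun_eq_iff mult_ac)
  finally have "(Bessel_integrand p x y has_integral I + I') {0..1}"
    using I by (intro has_integral_combine[where c = "1/2"]) auto
  then have "integral {0..1} (Bessel_integrand p x y) = I + I'"
    by (rule integral_unique)
  then show ?thesis
    using I I' by linarith
qed

end

section \<open>Angles away from the axes and the uniform estimate\<close>

text \<open>The minimum of \<bar>sin \<phi> cos \<phi>\<bar> over K serves as \<open>c\<close>: it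
  bounds both factors from below because each is at most 1. It is positive, since sin (2 \<psi>) = 0
  with \<psi> in [0, 2 pi) leaves only the four excluded angles.\<close>

lemma compact_away_from_axes:
  assumes "compact K" "K \<subseteq> {0..<2 * pi} - {0, pi / 2, pi, 3 / 2 * pi}"
  obtains c where "c > 0" "\<And>\<phi>. \<phi> \<in> K \<Longrightarrow> c \<le> \<bar>cos \<phi>\<bar> \<and> c \<le> \<bar>sin \<phi>\<bar>"
proof (cases "K = {}")
  case False
  obtain \<psi> where \<psi>: "\<psi> \<in> K" "\<And>\<phi>. \<phi> \<in> K \<Longrightarrow> \<bar>sin \<psi> * cos \<psi>\<bar> \<le> \<bar>sin \<phi> * cos \<phi>\<bar>"
    using continuous_attains_inf[OF \<open>compact K\<close> False, of "\<lambda>\<phi>. \<bar>sin \<phi> * cos \<phi>\<bar>"]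
    by (force intro!: continuous_intros)
  show thesis
  proof
    show "\<bar>sin \<psi> * cos \<psi>\<bar> > 0"
    proof (rule ccontr)
      assume "\<not> ?thesis"
      then have "sin (2 * \<psi>) = 0"
        by (simp add: sin_double)
      then obtain i :: int where i: "2 * \<psi> = of_int i * pi"
        using sin_zero_iff_int2 by blast
      have "0 \<le> \<psi>" "\<psi> < 2 * pi"
        using assms \<psi> by auto
      then have "0 \<le> of_int i * pi" "of_int i * pi < 4 * pi"
        using i by linarith+
      then have "0 \<le> real_of_int i" "real_of_int i < 4"
        using pi_gt_zero by (simp_all only: mult_less_cancel_right_pos zero_le_mult_iff) auto
      then have "i \<in> {0, 1, 2, 3}"
        by auto
      with i have "\<psi> \<in> {0, pi / 2, pi, 3 / 2 * pi}"
        by auto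
      then show False
        using assms \<psi> by blast
    qed
    fix \<phi> assume "\<phi> \<in> K"
    then have le: "\<bar>sin \<psi> * cos \<psi>\<bar> \<le> \<bar>sin \<phi>\<bar> * \<bar>cos \<phi>\<bar>"
      using \<psi> by (simp add: abs_mult)
    have "\<bar>sin \<phi>\<bar> * \<bar>cos \<phi>\<bar> \<le> \<bar>cos \<phi>\<bar>" "\<bar>sin \<phi>\<bar> * \<bar>cos \<phi>\<bar> \<le> \<bar>sin \<phi>\<bar>"
      by (auto intro!: mult_left_le_one_le mult_left_le)
    with le show "\<bar>sin \<psi> * cos \<psi>\<bar> \<le> \<bar>cos \<phi>\<bar> \<and> \<bar>sin \<psi> * cos \<psi>\<bar> \<le> \<bar>sin \<phi>\<bar>"
      by linarith
  qed
qed (use that[of 1] in auto)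

theorem theorem1p4:
  fixes p :: real
  assumes "0 < p \<and> p < 1 \<or> p = 2"
  shows "\<forall>K. compact K \<and> K \<subseteq> {0..<2 * pi} - {0, pi / 2, pi, 3 / 2 * pi} \<longrightarrow>
           (\<exists>C>0. \<exists>R>0. \<forall>\<eta>. \<forall>\<phi>\<in>K. has_angle p \<eta> \<phi> \<and> p_abs p \<eta> \<ge> R \<longrightarrow>
              \<bar>gen_Bessel_J0 p \<eta>\<bar> \<le> C * p_abs p \<eta> powr (- (1 / 2)))"
proof (intro allI impI, elim conjE)
  fix K assume K: "compact K" "K \<subseteq> {0..<2 * pi} - {0, pi / 2, pi, 3 / 2 * pi}"
  have p: "0 < p" "p \<le> 2" "p \<noteq> 1"
    using assms by auto
  obtain c where c: "c > 0" "\<And>\<phi>. \<phi> \<in> K \<Longrightarrow> c \<le> \<bar>cos \<phi>\<bar> \<and> c \<le> \<bar>sin \<phi>\<bar>"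
    using compact_away_from_axes[OF K] by blast
  \<comment> \<open>Both coordinates of \<eta> have absolute value at least c^(2/p) times
    \<open>p_abs p \<eta>\<close>, so \<open>\<kappa> * p_abs p \<eta>\<close> is a common lower
    bound for the curvature parameters of the two halves.\<close>
  define \<kappa> where "\<kappa> = curvature_bound p * c powr (2 / p)"
  define G where "G = 1 / (Gamma (1 / p))\<^sup>2 * (2 / p)\<^sup>2"
  \<comment> \<open>80 = 40 + 40, one contribution from each half of the integral.\<close>
  define C where "C = G * (80 * p * amplitude_bound p / sqrt \<kappa>)"
  have \<kappa>: "\<kappa> > 0"
    using c curvature_bound_pos[OF p] by (simp add: \<kappa>_def)
  have G: "G > 0"
    using p Gamma_real_pos[of "1 / p"] unfolding G_def
    by (intro mult_pos_pos divide_pos_pos zero_less_power) auto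
  have amp: "amplitude_bound p > 0"
    by (simp add: amplitude_bound_def less_max_iff_disj)
  have "C > 0"
    using G amp \<kappa> p by (simp add: C_def)
  moreover have "\<bar>gen_Bessel_J0 p \<eta>\<bar> \<le> C * p_abs p \<eta> powr (- (1 / 2))"
    if "\<phi> \<in> K" and ang: "has_angle p \<eta> \<phi>" and r: "p_abs p \<eta> \<ge> 1" for \<eta> \<phi>
  proof -
    let ?r = "p_abs p \<eta>"
    \<comment> \<open>To be used with v = cos \<phi> and v = sin \<phi>; it also yields the
      nonvanishing of the coordinates required by \<open>Bessel_integral_bound\<close>.\<close>
    have bound: "40 * p * amplitude_bound p / sqrt (curvature_bound p * \<bar>z\<bar>)
        \<le> 40 * p * amplitude_bound p / sqrt (\<kappa> * ?r) \<and> z \<noteq> 0"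
      if "c \<le> \<bar>v\<bar>" "z = sgn v * ?r * \<bar>v\<bar> powr (2 / p)" for z v
    proof -
      have "v \<noteq> 0"
        using that c by auto
      then have z: "\<bar>z\<bar> = ?r * \<bar>v\<bar> powr (2 / p)"
        using that r by (simp add: abs_mult abs_sgn_eq)
      have "c powr (2 / p) \<le> \<bar>v\<bar> powr (2 / p)"
        using that c p by (intro powr_mono2) auto
      then have "\<kappa> * ?r \<le> curvature_bound p * \<bar>z\<bar>"
        using r curvature_bound_pos[OF p] by (simp add: z \<kappa>_def mult_ac mult_left_mono)
      moreover have "\<kappa> * ?r > 0"
        using \<kappa> r by simp
      ultimately show ?thesis
        using p amp by (auto intro!: divide_left_mono mult_pos_pos)
    qed
    have \<eta>: "\<eta> $ 1 = sgn (cos \<phi>) * ?r * \<bar>cos \<phi>\<bar> powr (2 / p)"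
        "\<eta> $ 2 = sgn (sin \<phi>) * ?r * \<bar>sin \<phi>\<bar> powr (2 / p)"
      using ang by (auto simp: has_angle_def)
    note b = bound[OF conjunct1[OF c(2)[OF \<open>\<phi> \<in> K\<close>]] \<eta>(1)]
      bound[OF conjunct2[OF c(2)[OF \<open>\<phi> \<in> K\<close>]] \<eta>(2)]
    have "\<bar>integral {0..1} (Bessel_integrand p (\<eta> $ 1) (\<eta> $ 2))\<bar>
        \<le> 2 * (40 * p * amplitude_bound p / sqrt (\<kappa> * ?r))"
      using order_trans[OF Bessel_integral_bound[OF p conjunct2[OF b(1)] conjunct2[OF b(2)]]
          add_mono[OF conjunct1[OF b(1)] conjunct1[OF b(2)]]]
      by (simp only: mult_2)
    then have "G * \<bar>integral {0..1} (Bessel_integrand p (\<eta> $ 1) (\<eta> $ 2))\<bar>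
        \<le> G * (2 * (40 * p * amplitude_bound p / sqrt (\<kappa> * ?r)))"
      using G by (intro mult_left_mono) auto
    also have "\<dots> = C * ?r powr (- (1 / 2))"
      using r by (simp add: C_def real_sqrt_mult powr_minus powr_half_sqrt field_simps)
    finally have le: "G * \<bar>integral {0..1} (Bessel_integrand p (\<eta> $ 1) (\<eta> $ 2))\<bar>
        \<le> C * ?r powr (- (1 / 2))" .
    have "gen_Bessel_J0 p \<eta> = G * integral {0..1} (Bessel_integrand p (\<eta> $ 1) (\<eta> $ 2))"
      unfolding gen_Bessel_J0_def G_def Bessel_integrand_def[abs_def] by (rule refl)
    with le G show ?thesis
      by (simp add: abs_mult)
  qed
  ultimately show "\<exists>C>0. \<exists>R>0. \<forall>\<eta>. \<forall>\<phi>\<in>K. has_angle p \<eta> \<phi> \<and> p_abs p \<eta> \<ge> R \<longrightarrow>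
      \<bar>gen_Bessel_J0 p \<eta>\<bar> \<le> C * p_abs p \<eta> powr (- (1 / 2))"
    \<comment> \<open>The witness for R is 1, the threshold in assumption \<open>r\<close>.\<close>
    using zero_less_one by blast
qed

end
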